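(* Let $G$ be a non-bipartite Eulerian graph of genus $g$ with $m$ edges, $T$ a spanning tree of $G$, and $\gamma_T$ the canonical element in $M_2(E^c(T))$. Let $\{S_1,S_2\}$ be any partition of $M_2(E^c(T))$ such that for every $\gamma\in M_2(E^c(T))$, $\gamma\ne\gamma+\gamma_T$, and if $\gamma\in S_1$ then $\gamma+\gamma_T\in S_2$. Then for $i=1,2$, $$\operatorname{ec}(G)=\frac{1}{m\cdot 2^{g-1}}\sum_{\gamma\in S_i}(-1)^{\sigma(\gamma)}\operatorname{trace}\left(W_{1,\gamma}^m\right)=\frac{1}{m\cdot 2^{g-1}}\sum_{\gamma\in S_i}(-1)^{\sigma(\gamma)}\operatorname{trace}\left(A_\gamma^m\right).$$
   Context: A graph is connected and finite, loops and multiple edges allowed, vertices $v_1,\dots,v_n$, edges $e_1,\dots,e_m$, genus $g=m-n+1$. Each edge gives two mutually inverse oriented edges; $\mathbf e(0),\mathbf e(1)$ are initial/terminal vertices; $\mathbf E(G)$ is the set of $2m$ oriented edges. An Eulerian circuit is a closed walk (sequence of oriented edges, each starting where the previous ends, ending where it started) traversing each edge exactly once; $G$ is Eulerian if it has one; $\operatorname{ec}(G)$ is the number of Eulerian circuits up to cyclic rotation (a circuit and its reversal are distinct). $E^c(T)$ is the set of edges not in $T$; $M_2(E^c(T))$ is the $\mathbb Z/2\mathbb Z$-vector space of formal sums $\gamma=\sum_{e\in E^c(T)}c_e e$, $\sigma(\gamma)=\sum c_e\in\mathbb Z/2\mathbb Z$. The canonical element $\gamma_T\in M_2(E^c(T))$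 has $c_e=0$ if the unique path in $T$ joining the endpoints of $e$ has odd length, and $c_e=1$ otherwise. For $\gamma\in M_2(E^c(T))$ and oriented edge $\mathbf e$ with underlying edge $e$, $\chi_\gamma(\mathbf e)=(-1)^{c_e}$ ($c_e=0$ for $e\in T$). $A_\gamma$: $n\times n$ with $(i,j)$ entry $\sum\chi_\gamma(\mathbf e)$ over oriented edges from $v_i$ to $v_j$. $\mathbf e$ feeds into $\mathbf e'$ if $\mathbf e'\ne\mathbf e^{-1}$ and $\mathbf e(1)=\mathbf e'(0)$; $W_{1,\gamma}$: $2m\times2m$ indexed by $\mathbf E(G)$ with $(\mathbf e,\mathbf e')$ entry $\chi_\gamma(\mathbf e)$ if $\mathbf e$ feeds into $\mathbf e'$, else $0$.
   Formalization: The partition is also required to satisfy: if γ is in S_2 then γ+γ_T is in S_1; with only the stated implication the claim fails, e.g. for two loops at one vertex with S_1={(1,0)}, where the S_1-sum is 0 but ec(G)=4. *)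

theory Defs
  imports
    "Graph_Theory.Bidirected_Digraph"
    "Graph_Theory.Digraph_Component"
    "Jordan_Normal_Form.Matrix"
    "HOL-Library.Disjoint_Sets"
    "HOL-Library.Function_Algebras"
    "HOL-Library.Z2"
begin

text \<open>
  A finite connected undirected graph, loops and multiple edges allowed, is given by its
  oriented edges: \<^term>\<open>arcs G\<close> is the set of oriented edges, \<^term>\<open>tail G\<close> and \<^term>\<open>head G\<close> give
  the initial and terminal vertices, and \<open>arev\<close> maps an oriented edge to its inverse.  On
  \<^term>\<open>arcs G\<close> the map \<open>arev\<close> is an involution without fixed points, so a loop also has two
  distinct orientations.  (Outside \<^term>\<open>arcs G\<close>, \<open>arev\<close> is the identity by convention.)
\<close>

locale multigraph = bidirected_digraph G arev + fin_digraph G for G arev +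
  assumes connected: "connected G"

text \<open>An unoriented edge is the pair of its two orientations.\<close>

definition edge_of :: "('a \<Rightarrow> 'a) \<Rightarrow> 'a \<Rightarrow> 'a set" where
  "edge_of arev a = {a, arev a}"

definition edges :: "('v, 'a) pre_digraph \<Rightarrow> ('a \<Rightarrow> 'a) \<Rightarrow> 'a set set" where
  "edges G arev = edge_of arev ` arcs G"

definition genus :: "('v, 'a) pre_digraph \<Rightarrow> ('a \<Rightarrow> 'a) \<Rightarrow> int" where
  "genus G arev = int (card (edges G arev)) - int (card (verts G)) + 1"

definition bipartite :: "('v, 'a) pre_digraph \<Rightarrow> bool" where
  "bipartite G \<longleftrightarrow> (\<exists>X Y. X \<union> Y = verts G \<and> X \<inter> Y = {} \<and>
     (\<forall>a\<in>arcs G. tail G a \<in> X \<and> head G a \<in> Y \<or> tail G a \<in> Y \<and> head G a \<in> X))"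


definition eulerian_circuit :: "('v, 'a) pre_digraph \<Rightarrow> ('a \<Rightarrow> 'a) \<Rightarrow> 'a list \<Rightarrow> bool" where
  "eulerian_circuit G arev p \<longleftrightarrow> (\<exists>u. pre_digraph.awalk G u p u) \<and>
     (\<forall>e\<in>edges G arev. count_list (map (edge_of arev) p) e = 1)"

definition eulerian :: "('v, 'a) pre_digraph \<Rightarrow> ('a \<Rightarrow> 'a) \<Rightarrow> bool" where
  "eulerian G arev \<longleftrightarrow> (\<exists>p. eulerian_circuit G arev p)"

definition rotation_rel :: "'a list rel" where
  "rotation_rel = {(p, q). \<exists>k. q = rotate k p}"

text \<open>
  Rotation classes are taken of sequences of oriented edges, so a circuit and its reversal
  are counted separately.
\<close>

definition ec :: "('v, 'a) pre_digraph \<Rightarrow> ('a \<Rightarrow> 'a) \<Rightarrow> nat" where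
  "ec G arev = card ({p. eulerian_circuit G arev p} // rotation_rel)"


text \<open>
  A spanning tree is given as a subgraph closed under reversal of oriented edges.  The
  library's \<^const>\<open>tree\<close> and \<^const>\<open>spanning_tree\<close> cannot be used: they exclude every directed
  cycle, including the walk along an edge and back.  Here a cycle is required to traverse
  pairwise distinct unoriented edges; loops and pairs of parallel edges are cycles.
\<close>

definition is_spanning_tree ::
    "('v, 'a) pre_digraph \<Rightarrow> ('a \<Rightarrow> 'a) \<Rightarrow> ('v, 'a) pre_digraph \<Rightarrow> bool" where
  "is_spanning_tree G arev T \<longleftrightarrow>
     spanning T G \<and> (\<forall>a\<in>arcs T. arev a \<in> arcs T) \<and> connected T \<and>
     \<not> (\<exists>p. pre_digraph.cycle T p \<and> distinct (map (edge_of arev) p))"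

definition coedges ::
    "('v, 'a) pre_digraph \<Rightarrow> ('a \<Rightarrow> 'a) \<Rightarrow> ('v, 'a) pre_digraph \<Rightarrow> 'a set set" where
  "coedges G arev T = edges G arev - edges T arev"

text \<open>
  The formal sums over a finite set \<open>E\<close> of edges with coefficients in the field \<^typ>\<open>bit\<close> with
  two elements: the coefficient functions that vanish outside \<open>E\<close>, with pointwise addition.
\<close>

definition M2 :: "'a set set \<Rightarrow> ('a set \<Rightarrow> bit) set" where
  "M2 E = {\<gamma>. \<forall>e. e \<notin> E \<longrightarrow> \<gamma> e = 0}"

definition \<sigma> :: "'a set set \<Rightarrow> ('a set \<Rightarrow> bit) \<Rightarrow> bit" where
  "\<sigma> E \<gamma> = (\<Sum>e\<in>E. \<gamma> e)"

text \<open>The power of $-1$ with exponent in the integers modulo 2.\<close>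

definition neg_one_pow :: "bit \<Rightarrow> real" where
  "neg_one_pow c = (if c = 0 then 1 else - 1)"

text \<open>The unique path in the tree \<open>T\<close> from \<open>u\<close> to \<open>v\<close> (empty if \<open>u = v\<close>).\<close>

definition tree_path :: "('v, 'a) pre_digraph \<Rightarrow> 'v \<Rightarrow> 'v \<Rightarrow> 'a list" where
  "tree_path T u v = (THE p. pre_digraph.apath T u p v)"

text \<open>
  The two orientations \<open>a\<close> of an edge yield mutually reverse paths, so the parity below does
  not depend on the choice of \<open>a\<close>.
\<close>

definition canonical ::
    "('v, 'a) pre_digraph \<Rightarrow> ('a \<Rightarrow> 'a) \<Rightarrow> ('v, 'a) pre_digraph \<Rightarrow> 'a set \<Rightarrow> bit" where
  "canonical G arev T e =
     (if e \<in> coedges G arev T \<and> \<not> (\<exists>a\<in>e. odd (length (tree_path T (tail G a) (head G a))))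
      then 1 else 0)"

text \<open>For \<open>\<gamma>\<close> in \<^term>\<open>M2 (coedges G arev T)\<close> this is $1$ on the oriented edges of \<open>T\<close>.\<close>

definition \<chi> :: "('a \<Rightarrow> 'a) \<Rightarrow> ('a set \<Rightarrow> bit) \<Rightarrow> 'a \<Rightarrow> real" where
  "\<chi> arev \<gamma> a = neg_one_pow (\<gamma> (edge_of arev a))"

definition feeds_into :: "('v, 'a) pre_digraph \<Rightarrow> ('a \<Rightarrow> 'a) \<Rightarrow> 'a \<Rightarrow> 'a \<Rightarrow> bool" where
  "feeds_into G arev a b \<longleftrightarrow> b \<noteq> arev a \<and> head G a = tail G b"

text \<open>
  The matrices depend on enumerations \<open>vs\<close> of the vertices and \<open>os\<close> of the oriented edges.
\<close>

definition adj_mat ::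
    "('v, 'a) pre_digraph \<Rightarrow> ('a \<Rightarrow> 'a) \<Rightarrow> 'v list \<Rightarrow> ('a set \<Rightarrow> bit) \<Rightarrow> real mat" where
  "adj_mat G arev vs \<gamma> = mat (length vs) (length vs)
     (\<lambda>(i, j). \<Sum>a\<in>{a \<in> arcs G. tail G a = vs ! i \<and> head G a = vs ! j}. \<chi> arev \<gamma> a)"

definition edge_mat ::
    "('v, 'a) pre_digraph \<Rightarrow> ('a \<Rightarrow> 'a) \<Rightarrow> 'a list \<Rightarrow> ('a set \<Rightarrow> bit) \<Rightarrow> real mat" where
  "edge_mat G arev os \<gamma> = mat (length os) (length os)
     (\<lambda>(i, j). if feeds_into G arev (os ! i) (os ! j) then \<chi> arev \<gamma> (os ! i) else 0)"

definition trace :: "'b::comm_monoid_add mat \<Rightarrow> 'b" where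
  "trace A = (\<Sum>i<dim_row A. A $$ (i, i))"

end

theory Submission
  imports Defs
begin

text \<open>
  The trace of the \<open>m\<close>-th power of either matrix is a signed count of closed walks of length \<open>m\<close>
  (without backtracking for the edge matrix).  Summed over all \<open>\<gamma>\<close> with the sign of \<open>\<sigma> \<gamma>\<close>, only the
  walks survive that use every edge outside the tree an odd number of times, each with
  weight $2^g$.  As \<open>G\<close> is Eulerian, the edges used an even number of times form an even
  subgraph, here one of the tree, so there are none; a walk of length \<open>m\<close> then uses every
  edge exactly once.

  Let \<open>c\<close> be the $\pm 1$-colouring of the vertices given by the tree.  Adding \<open>\<gamma>\<^sub>T\<close> multiplies the
  sign of an arc by minus the product of the colours of its ends, which amounts to $(-1)^m$ for a
  closed walk of length \<open>m\<close>; an Eulerian circuit shows that $(-1)^m$ is also the sign of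
  \<open>\<sigma> \<gamma>\<^sub>T\<close>.  Hence the summand is invariant under adding \<open>\<gamma>\<^sub>T\<close> and both halves of the sum agree.
\<close>

section \<open>Walks in the spanning tree\<close>

text \<open>Only neighbouring arcs are compared, the last one not with the first, so the condition
  is inherited by every contiguous part of a walk.\<close>

abbreviation nonbacktracking :: "('a \<Rightarrow> 'a) \<Rightarrow> 'a list \<Rightarrow> bool" where
  "nonbacktracking arev \<equiv> successively (\<lambda>a b. b \<noteq> arev a)"

locale multigraph_spanning_tree = multigraph G arev
  for G :: "('v, 'a) pre_digraph" and arev +
  fixes T :: "('v, 'a) pre_digraph"
  assumes spanning_tree: "is_spanning_tree G arev T"
begin

sublocale T: wf_digraph T
  using spanning_tree by (auto simp: is_spanning_tree_def spanning_def subgraph_def)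

lemma verts_T [simp]: "verts T = verts G"
  and tail_T [simp]: "tail T = tail G"
  and head_T [simp]: "head T = head G"
  and arcs_T_subset: "arcs T \<subseteq> arcs G"
  and arev_in_arcs_T [simp]: "a \<in> arcs T \<Longrightarrow> arev a \<in> arcs T"
  and connected_T: "connected T"
  and no_cycle_T: "T.cycle p \<Longrightarrow> \<not> distinct (map (edge_of arev) p)"
  using spanning_tree
  by (auto simp: is_spanning_tree_def spanning_def subgraph_def compatible_def)

lemma arcs_T_in_G [simp]: "a \<in> arcs T \<Longrightarrow> a \<in> arcs G"
  using arcs_T_subset by auto

lemma tail_nth_awalk_T:
  assumes "T.awalk u p v" "Suc i < length p"
  shows "tail G (p ! Suc i) = head G (p ! i)"
  using assms
proof (induction p arbitrary: u i)
  case (Cons a p)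
  then have p: "T.awalk (head G a) p v" by (simp add: T.awalk_Cons_iff)
  show ?case
  proof (cases i)
    case 0
    then obtain b p' where "p = b # p'" using Cons.prems(2) by (cases p) auto
    then show ?thesis using p 0 by (simp add: T.awalk_Cons_iff)
  next
    case (Suc j)
    then show ?thesis using Cons.IH[OF p, of j] Cons.prems(2) by simp
  qed
qed simp

text \<open>If positions i < j carried the same edge, equal arcs would repeat a head. Inverse arcs
  would make the head at i the tail at j, that is, the head at j - 1; so i = j - 1 and the walk
  would backtrack.\<close>

lemma distinct_edges_if_distinct_heads:
  assumes "T.awalk u p v" "distinct (map (head G) p)" "nonbacktracking arev p"
  shows "distinct (map (edge_of arev) p)"
proof -
  have ne: "edge_of arev (p ! i) \<noteq> edge_of arev (p ! j)" if ij: "i < j" "j < length p" for i j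
  proof
    assume "edge_of arev (p ! i) = edge_of arev (p ! j)"
    then consider "p ! j = p ! i" | "p ! j = arev (p ! i)"
      by (auto simp: edge_of_def doubleton_eq_iff)
    then show False
    proof cases
      case 1
      then have "map (head G) p ! j = map (head G) p ! i" using ij by simp
      then show False using ij nth_eq_iff_index_eq[OF assms(2), of j i] by simp
    next
      case 2
      have "p ! i \<in> arcs G" using assms(1) ij nth_mem[of i p] unfolding T.awalk_def by fastforce
      then have "map (head G) p ! i = map (head G) p ! (j - 1)"
        using 2 ij tail_nth_awalk_T[OF assms(1), of "j - 1"] by simp
      then have "i = j - 1" using ij nth_eq_iff_index_eq[OF assms(2), of i "j - 1"] by simp
      with ij have "Suc i = j" by simp
      moreover have "\<forall>i. Suc i < length p \<longrightarrow> p ! Suc i \<noteq> arev (p ! i)"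
        using assms(3) by (simp add: successively_conv_nth)
      ultimately show False using 2 ij by blast
    qed
  qed
  have "map (edge_of arev) p ! i \<noteq> map (edge_of arev) p ! j"
    if "i < length p" "j < length p" "i \<noteq> j" for i j
    using ne[of i j] ne[of j i] that by (cases i j rule: linorder_cases) auto
  then show ?thesis by (simp add: distinct_conv_nth)
qed

text \<open>Induction on the length: with distinct heads a nonempty walk would be a cycle with
  distinct edges, which the tree excludes; otherwise the part between two visits to one vertex is a
  shorter counterexample.\<close>

lemma closed_nonbacktracking_Nil:
  assumes "T.awalk u p u" "nonbacktracking arev p"
  shows "p = []"
  using assms
proof (induction "length p" arbitrary: u p rule: less_induct)
  case less
  show ?case
  proof (rule ccontr)
    assume ne: "p \<noteq> []"
    show False
    proof (cases "distinct (map (head G) p)")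
      case True
      have "T.awalk_verts u p = tail T (hd p) # map (head T) p"
        using T.awalk_verts_conv'[of u p u] less.prems(1) ne by auto
      then have "T.cycle p" unfolding T.cycle_def
        using True less.prems(1) ne by (intro exI[of _ u]) auto
      then show False
        using no_cycle_T distinct_edges_if_distinct_heads[OF less.prems(1) True less.prems(2)]
        by blast
    next
      case False
      then obtain xs ys zs h where "map (head G) p = xs @ [h] @ ys @ [h] @ zs"
        using not_distinct_decomp by blast
      then obtain xs' p1 where p1: "p = xs' @ p1" "map (head G) p1 = h # ys @ h # zs"
        by (auto simp: map_eq_append_conv)
      then obtain a p2 where p2: "p1 = a # p2" "head G a = h" "map (head G) p2 = ys @ h # zs"
        by (auto simp: map_eq_Cons_conv)
      then obtain ys' p3 where p3: "p2 = ys' @ p3" "map (head G) p3 = h # zs"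
        by (auto simp: map_eq_append_conv)
      then obtain b zs' where p4: "p3 = b # zs'" "head G b = h"
        by (auto simp: map_eq_Cons_conv)
      have p: "p = xs' @ [a] @ ys' @ [b] @ zs'" and h: "head G a = h" "head G b = h"
        using p1 p2 p3 p4 by simp_all
      \<comment> \<open>Dropping \<open>a\<close> makes this closed part strictly shorter, and its
        final arc \<open>b\<close> makes it nonempty.\<close>
      have w: "T.awalk h (ys' @ [b]) h"
        using less.prems(1) h unfolding p
        by (auto simp: T.awalk_append_iff T.awalk_Cons_iff T.awalk_Nil_iff)
      have "nonbacktracking arev (ys' @ [b])"
        using less.prems(2) unfolding p by (auto simp: successively_append_iff successively_Cons)
      then have "ys' @ [b] = []" using less.hyps[OF _ w] p by simp
      then show False by simp
    qed
  qed
qed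

lemma awalk_rev_T:
  assumes "T.awalk u p v"
  shows "T.awalk v (rev (map arev p)) u"
  using assms
proof (induction p arbitrary: u)
  case Nil
  then show ?case by (auto simp: T.awalk_Nil_iff)
next
  case (Cons a p)
  then have a: "a \<in> arcs T" "u = tail G a" "T.awalk (head G a) p v"
    by (auto simp: T.awalk_Cons_iff)
  have "T.awalk (head G a) [arev a] u"
    using a T.arc_implies_awalk[of "arev a"] by simp
  then show ?case using T.awalk_appendI[OF Cons.IH[OF a(3)]] by simp
qed

lemma nonbacktracking_rev:
  assumes "nonbacktracking arev p"
  shows "nonbacktracking arev (rev (map arev p))"
  unfolding successively_rev successively_map
  by (rule successively_mono[OF assms]) auto

text \<open>If the last arcs differ, concatenating one walk with the reverse of the other gives a
  nonempty closed walk without backtracking.\<close>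

lemma nonbacktracking_unique:
  assumes "T.awalk u p v" "nonbacktracking arev p" "T.awalk u q v" "nonbacktracking arev q"
  shows "p = q"
  using assms
proof (induction p arbitrary: q v rule: rev_induct)
  case Nil
  then have "u = v" by (simp add: T.awalk_Nil_iff)
  with Nil show ?case using closed_nonbacktracking_Nil by auto
next
  case (snoc a p)
  show ?case
  proof (cases q rule: rev_exhaust)
    case Nil
    then have "u = v" using snoc.prems by (simp add: T.awalk_Nil_iff)
    then show ?thesis using snoc.prems closed_nonbacktracking_Nil by blast
  next
    case q: (snoc q' b)
    have p': "T.awalk u p (tail G a)" "a \<in> arcs T" "head G a = v"
      and q': "T.awalk u q' (tail G b)" "b \<in> arcs T" "head G b = v"
      using snoc.prems q by (auto simp: T.awalk_Cons_iff T.awalk_Nil_iff)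
    have nb: "nonbacktracking arev p" "nonbacktracking arev q'"
      using snoc.prems q by (auto simp: successively_append_iff)
    show ?thesis
    proof (cases "a = b")
      case True
      then show ?thesis using snoc.IH[OF p'(1) nb(1), of q'] q' nb q by simp
    next
      case False
      let ?r = "rev (map arev (q' @ [b]))"
      have "T.awalk u ((p @ [a]) @ ?r) u"
        using snoc.prems(1,3) q by (blast intro: T.awalk_appendI awalk_rev_T)
      moreover have "nonbacktracking arev ((p @ [a]) @ ?r)"
        using snoc.prems(2) nonbacktracking_rev[OF snoc.prems(4)] q False
        by (simp only: successively_append_iff) (auto simp: arev_eq_iff)
      ultimately have "(p @ [a]) @ ?r = []" by (rule closed_nonbacktracking_Nil)
      then show ?thesis by simp
    qed
  qed
qed

text \<open>An arc followed by its inverse would return to its tail, a vertex already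
  visited.\<close>

lemma apath_nonbacktracking:
  assumes "T.apath u p v"
  shows "nonbacktracking arev p"
  using assms
proof (induction p arbitrary: u)
  case (Cons a p)
  show ?case
  proof (cases p)
    case (Cons b p')
    have "b \<noteq> arev a"
    proof
      assume "b = arev a"
      then have "head G b = tail G a" using Cons.prems by (auto simp: T.apath_Cons_iff)
      moreover have "head G b \<in> set (T.awalk_verts (head T a) p)"
        using Cons Cons.prems by (cases p') (auto simp: T.apath_Cons_iff)
      ultimately show False using Cons.prems by (auto simp: T.apath_Cons_iff)
    qed
    then show ?thesis using Cons Cons.IH[of "head G a"] Cons.prems
      by (auto simp: T.apath_Cons_iff)
  qed simp
qed simp

lemma apath_T_exists:
  assumes "u \<in> verts G" "v \<in> verts G"
  shows "\<exists>p. T.apath u p v"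
proof -
  have "symmetric T"
  proof (unfold symmetric_def, intro symI)
    fix u v assume "u \<rightarrow>\<^bsub>T\<^esub> v"
    then obtain a where "a \<in> arcs T" "u = tail G a" "v = head G a" by (auto simp: arcs_ends_conv)
    then show "v \<rightarrow>\<^bsub>T\<^esub> u" by (auto simp: arcs_ends_conv intro!: image_eqI[of _ _ "arev a"])
  qed
  then have "strongly_connected T"
    using T.symmetric_connected_imp_strongly_connected connected_T by blast
  then have "u \<rightarrow>\<^sup>*\<^bsub>T\<^esub> v" using assms by (auto simp: strongly_connected_def)
  then show ?thesis by (simp add: T.reachable_apath)
qed

text \<open>The description in \<open>tree_path\<close> is proper: simple paths do not backtrack,
  and walks without backtracking are determined by their ends.\<close>

lemma awalk_tree_path:
  assumes "u \<in> verts G" "v \<in> verts G"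
  shows "T.awalk u (tree_path T u v) v"
proof -
  have "\<exists>!p. T.apath u p v"
    using apath_T_exists[OF assms] nonbacktracking_unique[OF T.awalkI_apath apath_nonbacktracking
      T.awalkI_apath apath_nonbacktracking] by blast
  then have "T.apath u (tree_path T u v) v" unfolding tree_path_def by (rule theI')
  then show ?thesis by (rule T.awalkI_apath)
qed

section \<open>Depth below a root and the two-colouring of the tree\<close>

definition root :: 'v where
  "root = (SOME r. r \<in> verts G)"

definition root_path :: "'v \<Rightarrow> 'a list" where
  "root_path v = (SOME p. T.apath root p v)"

lemma root_in_verts: "root \<in> verts G"
  using connected_T unfolding root_def connected_def strongly_connected_def
  by (simp add: some_in_eq)

lemma root_path:
  assumes "v \<in> verts G"
  shows "T.awalk root (root_path v) v" "nonbacktracking arev (root_path v)"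
proof -
  have "T.apath root (root_path v) v"
    unfolding root_path_def using apath_T_exists[OF root_in_verts assms] by (rule someI_ex)
  then show "T.awalk root (root_path v) v" "nonbacktracking arev (root_path v)"
    using T.awalkI_apath apath_nonbacktracking by auto
qed

text \<open>Root paths can thus be recognised by a local condition, easier to check after adding or
  removing an arc than distinctness of the vertices.\<close>

lemma root_path_eqI:
  assumes "T.awalk root p v" "nonbacktracking arev p"
  shows "root_path v = p"
proof -
  have "v \<in> verts G" using T.awalk_last_in_verts[OF assms(1)] by simp
  then show ?thesis using nonbacktracking_unique[OF root_path assms] by blast
qed

text \<open>If the path to the tail ends with the inverse arc, removing it leaves a path to the
  head; otherwise appending the arc does not backtrack. Uniqueness identifies the result with the
  root path.\<close>

lemma root_path_arc:
  assumes "a \<in> arcs T"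
  shows "root_path (head G a) = root_path (tail G a) @ [a] \<or>
    root_path (tail G a) = root_path (head G a) @ [arev a]"
proof -
  let ?p = "root_path (tail G a)"
  have p: "T.awalk root ?p (tail G a)" "nonbacktracking arev ?p"
    using root_path[of "tail G a"] assms by auto
  show ?thesis
  proof (cases "\<exists>q. ?p = q @ [arev a]")
    case True
    then obtain q where q: "?p = q @ [arev a]" by blast
    have "T.awalk root q (head G a)"
      using p(1) assms unfolding q by (auto simp: T.awalk_Cons_iff T.awalk_Nil_iff)
    moreover have "nonbacktracking arev q"
      using p(2) unfolding q by (simp add: successively_append_iff)
    ultimately show ?thesis using root_path_eqI q by blast
  next
    case False
    have "T.awalk root (?p @ [a]) (head G a)"
      using T.awalk_appendI[OF p(1)] T.arc_implies_awalk[OF assms] by simp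
    moreover have "nonbacktracking arev (?p @ [a])"
      using p(2) False
      by (auto simp: successively_append_iff) (metis append_butlast_last_id arev_arev)
    ultimately show ?thesis using root_path_eqI by blast
  qed
qed

definition colour :: "'v \<Rightarrow> real" where
  "colour v = (- 1) ^ length (root_path v)"

lemma colour_square [simp]: "colour v * colour v = 1"
  by (simp add: colour_def flip: power_mult_distrib)

lemma colour_arc_T:
  assumes "a \<in> arcs T"
  shows "colour (tail G a) = - colour (head G a)"
  using root_path_arc[OF assms] by (auto simp: colour_def)

lemma colour_awalk_T:
  assumes "T.awalk u p v"
  shows "colour u = (- 1) ^ length p * colour v"
  using assms
proof (induction p arbitrary: u)
  case (Cons a p)
  then show ?case using colour_arc_T[of a] by (auto simp: T.awalk_Cons_iff)
qed (simp add: T.awalk_Nil_iff)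

text \<open>Translates the parity in \<open>canonical\<close> into a product of colours, which is
  symmetric in the two ends of an edge.\<close>

lemma colour_tree_path:
  assumes "u \<in> verts G" "v \<in> verts G"
  shows "colour u * colour v = (- 1) ^ length (tree_path T u v)"
  using colour_awalk_T[OF awalk_tree_path[OF assms]] by simp

text \<open>The tail of an arc of maximal depth in \<open>F\<close> meets \<open>F\<close> only in the edge towards the root.\<close>

lemma even_subset_of_T_empty:
  assumes "F \<subseteq> arcs T" "\<And>a. a \<in> F \<Longrightarrow> arev a \<in> F"
    and "\<And>v. v \<in> verts G \<Longrightarrow> even (card {a \<in> F. tail G a = v})"
  shows "F = {}"
proof (rule ccontr)
  assume ne: "F \<noteq> {}"
  have "finite F" using assms(1) arcs_T_subset by (meson finite_arcs finite_subset)
  let ?d = "\<lambda>a. length (root_path (tail G a))"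
  have "Max (?d ` F) \<in> ?d ` F"
    using ne \<open>finite F\<close> by (intro Max_in) auto
  then obtain a where a: "a \<in> F" and eq: "Max (?d ` F) = ?d a" by auto
  have max: "?d b \<le> ?d a" if "b \<in> F" for b
    using \<open>finite F\<close> that unfolding eq[symmetric] by (intro Max_ge) auto
  \<comment> \<open>The reverse of \<open>b\<close> is also in \<open>F\<close>, so by maximality
    \<open>b\<close> cannot lead away from the root; hence its inverse ends the root path.\<close>
  have last: "last (root_path (tail G a)) = arev b" if b: "b \<in> F" "tail G b = tail G a" for b
  proof -
    have "b \<in> arcs T" using b assms(1) by auto
    moreover have "length (root_path (head G b)) \<le> length (root_path (tail G a))"
      using max[OF assms(2)[OF b(1)]] \<open>b \<in> arcs T\<close> by simp
    ultimately show ?thesis using root_path_arc[of b] b(2) by auto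
  qed
  have "{b \<in> F. tail G b = tail G a} = {a}"
  proof (intro equalityI subsetI)
    fix b assume "b \<in> {b \<in> F. tail G b = tail G a}"
    then have "arev b = arev a" using last[of b] last[OF a refl] by simp
    then show "b \<in> {a}" by (simp add: arev_eq_iff)
  qed (use a in simp)
  moreover have "tail G a \<in> verts G" using a assms(1) by auto
  ultimately show False using assms(3)[of "tail G a"] by simp
qed

text \<open>The edges of the tree correspond to the vertices other than the root: the edge towards the
  root is the last one of the path from the root.\<close>

lemma card_edges_T: "card (edges T arev) + 1 = card (verts G)"
proof -
  let ?f = "\<lambda>v. edge_of arev (last (root_path v))"
  have root: "root_path root = []"
    by (rule root_path_eqI) (simp_all add: T.awalk_Nil_iff root_in_verts)
  have split: "\<exists>q a. root_path v = q @ [a] \<and> a \<in> arcs T \<and> head G a = v \<and> root_path (tail G a) = q"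
    if v: "v \<in> verts G" "v \<noteq> root" for v
  proof -
    note p = root_path[OF v(1)]
    have "root_path v \<noteq> []" using p(1) v(2) by (auto simp: T.awalk_Nil_iff)
    then obtain q a where q: "root_path v = q @ [a]" by (metis append_butlast_last_id)
    have "T.awalk root q (tail G a)" "a \<in> arcs T" "head G a = v"
      using p(1) unfolding q by (auto simp: T.awalk_Cons_iff T.awalk_Nil_iff)
    moreover have "nonbacktracking arev q"
      using p(2) unfolding q by (simp add: successively_append_iff)
    ultimately show ?thesis using q root_path_eqI by blast
  qed
  have "inj_on ?f (verts G - {root})"
  proof (rule inj_onI)
    fix u v assume u: "u \<in> verts G - {root}" and v: "v \<in> verts G - {root}" and eq: "?f u = ?f v"
    obtain q a where a: "root_path u = q @ [a]" "a \<in> arcs T" "head G a = u" "root_path (tail G a) = q"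
      using split[of u] u by auto
    obtain r b where b: "root_path v = r @ [b]" "b \<in> arcs T" "head G b = v" "root_path (tail G b) = r"
      using split[of v] v by auto
    have "b = a \<or> b = arev a" using eq a b by (auto simp: edge_of_def doubleton_eq_iff)
    then show "u = v"
    proof
      \<comment> \<open>Each of the two root paths would extend the other by one arc.\<close>
      assume "b = arev a"
      then have "q = r @ [b]" "r = q @ [a]" using a b by simp_all
      then have "length q = length q + 2" by simp
      then show ?thesis by simp
    qed (use a b in simp)
  qed
  moreover have "?f ` (verts G - {root}) = edges T arev"
  proof (intro equalityI subsetI)
    fix e assume "e \<in> ?f ` (verts G - {root})"
    then obtain v where v: "v \<in> verts G" "v \<noteq> root" "e = ?f v" by auto
    then show "e \<in> edges T arev" using split[OF v(1,2)] by (auto simp: edges_def)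
  next
    fix e assume "e \<in> edges T arev"
    then obtain a where a: "a \<in> arcs T" "e = edge_of arev a" by (auto simp: edges_def)
    have vs: "tail G a \<in> verts G" "head G a \<in> verts G" using a by auto
    show "e \<in> ?f ` (verts G - {root})"
      using root_path_arc[OF a(1)]
    proof
      assume *: "root_path (head G a) = root_path (tail G a) @ [a]"
      then have "head G a \<noteq> root" using root by auto
      then show ?thesis using * a vs by (intro image_eqI[of _ _ "head G a"]) auto
    next
      assume *: "root_path (tail G a) = root_path (head G a) @ [arev a]"
      then have "tail G a \<noteq> root" using root by auto
      then show ?thesis using * a vs
        by (intro image_eqI[of _ _ "tail G a"]) (auto simp: edge_of_def)
    qed
  qed
  ultimately have "card (edges T arev) = card (verts G - {root})"
    by (metis card_image)
  moreover have "card (verts G) > 0" using root_in_verts by (auto simp: card_gt_0_iff)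
  ultimately show ?thesis using root_in_verts by simp
qed

end

section \<open>Signs\<close>

lemma neg_one_pow_simps [simp]: "neg_one_pow 0 = 1" "neg_one_pow 1 = - 1"
  by (simp_all add: neg_one_pow_def)

lemma neg_one_pow_add: "neg_one_pow (a + b) = neg_one_pow a * neg_one_pow b"
  by (cases a; cases b) simp_all

lemma UNIV_bit: "(UNIV :: bit set) = {0, 1}"
  by auto

lemma neg_one_pow_sum: "neg_one_pow (\<Sum>e\<in>E. f e) = (\<Prod>e\<in>E. neg_one_pow (f e))"
  by (induction E rule: infinite_finite_induct) (simp_all add: neg_one_pow_add del: add_bit_eq_xor)

lemma finite_M2:
  assumes "finite E"
  shows "finite (M2 E)"
proof (rule finite_subset)
  show "M2 E \<subseteq> {f. \<forall>e. (e \<in> E \<longrightarrow> f e \<in> UNIV) \<and> (e \<notin> E \<longrightarrow> f e = 0)}"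
    by (auto simp: M2_def)
  show "finite {f. \<forall>e. (e \<in> E \<longrightarrow> f e \<in> (UNIV :: bit set)) \<and> (e \<notin> E \<longrightarrow> f e = 0)}"
    using assms by (intro finite_set_of_finite_funs) (auto simp: UNIV_bit)
qed

text \<open>The coefficients at different edges are independent, so the product of sums expands into
  a sum over all choices of coefficients.\<close>

lemma sum_M2_prod:
  fixes f :: "'a set \<Rightarrow> bit \<Rightarrow> real"
  assumes "finite E"
  shows "(\<Sum>\<gamma>\<in>M2 E. \<Prod>e\<in>E. f e (\<gamma> e)) = (\<Prod>e\<in>E. f e 0 + f e 1)"
proof -
  have "(\<Prod>e\<in>E. f e 0 + f e 1) = (\<Prod>e\<in>E. \<Sum>c\<in>UNIV. f e c)"
    by (simp add: UNIV_bit)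
  also have "\<dots> = (\<Sum>g\<in>PiE E (\<lambda>_. UNIV). \<Prod>e\<in>E. f e (g e))"
    using assms by (intro prod_sum_PiE) (auto simp: UNIV_bit)
  \<comment> \<open>Both index sets encode the functions on \<open>E\<close>: outside
    \<open>E\<close> those in \<open>M2\<close> are 0, those in \<open>PiE\<close> are
    \<open>undefined\<close>.\<close>
  also have "\<dots> = (\<Sum>\<gamma>\<in>M2 E. \<Prod>e\<in>E. f e (\<gamma> e))"
    by (rule sum.reindex_bij_witness[of _ "\<lambda>\<gamma>. restrict \<gamma> E" "\<lambda>g e. if e \<in> E then g e else 0"])
      (auto simp: M2_def PiE_def extensional_def fun_eq_iff intro!: prod.cong)
  finally show ?thesis by simp
qed

section \<open>Weights of walks and their signed sums over the coefficient functions\<close>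

definition walk_weight :: "('a \<Rightarrow> 'a) \<Rightarrow> ('a set \<Rightarrow> bit) \<Rightarrow> 'a list \<Rightarrow> real" where
  "walk_weight arev \<gamma> p = prod_list (map (\<chi> arev \<gamma>) p)"

text \<open>Arcs are grouped by their edge, both orientations having the same sign; arcs whose edge
  lies outside \<open>E\<close> contribute 1 because \<gamma> vanishes there.\<close>

lemma walk_weight_eq_prod_edges:
  assumes "finite E" "\<gamma> \<in> M2 E"
  shows "walk_weight arev \<gamma> p
    = (\<Prod>e\<in>E. neg_one_pow (\<gamma> e) ^ count_list (map (edge_of arev) p) e)"
proof (induction p)
  case Nil
  then show ?case by (simp add: walk_weight_def)
next
  case (Cons a p)
  have "\<chi> arev \<gamma> a = (\<Prod>e\<in>E. if e = edge_of arev a then neg_one_pow (\<gamma> e) else 1)"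
    using assms by (auto simp: \<chi>_def M2_def)
  then show ?case using Cons
    by (auto simp: walk_weight_def simp flip: prod.distrib intro!: prod.cong)
qed

text \<open>The sum factors over the edges; one traversed N times contributes 1 + (-1)^(N + 1),
  which is 2 for odd N and 0 for even N.\<close>

lemma sum_M2_walk_weight:
  assumes "finite E"
  shows "(\<Sum>\<gamma>\<in>M2 E. neg_one_pow (\<sigma> E \<gamma>) * walk_weight arev \<gamma> p)
    = (if \<forall>e\<in>E. odd (count_list (map (edge_of arev) p) e) then 2 ^ card E else 0)"
proof -
  let ?N = "\<lambda>e. count_list (map (edge_of arev) p) e"
  have "(\<Sum>\<gamma>\<in>M2 E. neg_one_pow (\<sigma> E \<gamma>) * walk_weight arev \<gamma> p)
    = (\<Sum>\<gamma>\<in>M2 E. \<Prod>e\<in>E. neg_one_pow (\<gamma> e) ^ Suc (?N e))"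
    using assms
    by (intro sum.cong) (simp_all add: walk_weight_eq_prod_edges \<sigma>_def neg_one_pow_sum prod.distrib)
  also have "\<dots> = (\<Prod>e\<in>E. 1 ^ Suc (?N e) + (- 1) ^ Suc (?N e))"
    using sum_M2_prod[OF assms, of "\<lambda>e c. neg_one_pow c ^ Suc (?N e)"] by simp
  also have "\<dots> = (\<Prod>e\<in>E. if odd (?N e) then 2 else 0)"
    by (intro prod.cong) auto
  also have "\<dots> = (if \<forall>e\<in>E. odd (?N e) then 2 ^ card E else 0)"
    using assms by auto
  finally show ?thesis .
qed

section \<open>Eulerian circuits\<close>

lemma equiv_rotation_rel: "equiv UNIV (rotation_rel :: 'a list rel)"
proof -
  have "sym (rotation_rel :: 'a list rel)"
  proof (rule symI)
    fix p q :: "'a list" assume "(p, q) \<in> rotation_rel"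
    then obtain k where q: "q = rotate k p" by (auto simp: rotation_rel_def)
    \<comment> \<open>Reducing \<open>k\<close> modulo the length keeps the subtraction of natural
      numbers from being cut off at 0.\<close>
    have "p = rotate (length p - k mod length p) q"
    proof (cases "p = []")
      case False
      then have "q = rotate (k mod length p) p" using q by (simp add: rotate_conv_mod[symmetric])
      then have "rotate (length p - k mod length p) q = rotate (length p) p"
        using False by (simp add: rotate_rotate)
      then show ?thesis by simp
    qed (use q in simp)
    then show "(q, p) \<in> rotation_rel" by (auto simp: rotation_rel_def)
  qed
  moreover have "trans (rotation_rel :: 'a list rel)"
    by (rule transI) (auto simp: rotation_rel_def rotate_rotate)
  moreover have "refl (rotation_rel :: 'a list rel)"
    by (auto simp: rotation_rel_def refl_on_def intro: exI[of _ 0])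
  ultimately show ?thesis by (simp add: equiv_def)
qed

text \<open>Rotations by different amounts below the length start with different entries.\<close>

lemma card_rotation_class:
  assumes "distinct p" "p \<noteq> []"
  shows "card (rotation_rel `` {p}) = length p"
proof -
  have "rotation_rel `` {p} = (\<lambda>k. rotate k p) ` {..<length p}"
  proof (intro equalityI subsetI)
    fix q assume "q \<in> rotation_rel `` {p}"
    then obtain k where "q = rotate k p" by (auto simp: rotation_rel_def)
    then have "q = rotate (k mod length p) p" by (simp add: rotate_conv_mod[symmetric])
    then show "q \<in> (\<lambda>k. rotate k p) ` {..<length p}" using assms by auto
  qed (auto simp: rotation_rel_def)
  moreover have "inj_on (\<lambda>k. rotate k p) {..<length p}"
  proof (rule inj_onI)
    fix j k assume jk: "j \<in> {..<length p}" "k \<in> {..<length p}" "rotate j p = rotate k p"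
    have "hd (rotate i p) = p ! i" if "i < length p" for i
      using hd_rotate_conv_nth[OF assms(2), of i] that by simp
    from this[of j] this[of k] have "p ! j = p ! k" using jk by simp
    then show "j = k" using nth_eq_iff_index_eq[OF assms(1), of j k] jk by simp
  qed
  ultimately show ?thesis by (simp add: card_image)
qed

context multigraph
begin

text \<open>The vertex sequence is the starting vertex followed by the heads, and also the tails
  followed by the final head. The cyclic shift makes counts and products over heads agree with those
  over tails.\<close>

lemma head_closed_walk:
  assumes "awalk u p u"
  shows "map (head G) p = rotate1 (map (tail G) p)"
proof (cases p)
  case (Cons a q)
  have "awalk_verts u p = tail G a # map (head G) p"
    using awalk_verts_conv'[of u p u] assms Cons by auto
  moreover have "awalk_verts u p = map (tail G) p @ [head G (last p)]"
    using awalk_verts_conv[of u p] Cons by simp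
  moreover have "head G (last p) = u" "tail G a = u"
    using assms Cons awlast_of_awalk[OF assms]
    by (auto simp: awalk_verts_conv awalk_Cons_iff split: if_splits)
  ultimately show ?thesis using Cons by simp
qed simp

lemma edge_of_eq_iff: "edge_of arev a = edge_of arev b \<longleftrightarrow> a = b \<or> a = arev b"
  by (auto simp: edge_of_def doubleton_eq_iff)

lemma count_edge_of:
  assumes "a \<in> arcs G"
  shows "count_list (map (edge_of arev) p) (edge_of arev a)
    = count_list p a + count_list p (arev a)"
proof (induction p)
  case (Cons b p)
  have "edge_of arev b = edge_of arev a \<longleftrightarrow> b = a \<or> b = arev a" by (rule edge_of_eq_iff)
  then show ?case using Cons arev_neq[OF assms] by simp
qed simp

lemma sum_count_list:
  assumes "finite A" "set p \<subseteq> A"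
  shows "(\<Sum>a\<in>{a \<in> A. f a = v}. count_list p a) = count_list (map f p) v"
  using assms(2)
proof (induction p)
  case (Cons b p)
  have "(\<Sum>a\<in>{a \<in> A. f a = v}. count_list (b # p) a)
    = (\<Sum>a\<in>{a \<in> A. f a = v}. count_list p a) + (\<Sum>a\<in>{a \<in> A. f a = v}. if a = b then 1 else 0)"
    by (subst sum.distrib[symmetric]) (auto intro!: sum.cong)
  then show ?case using Cons assms(1) by auto
qed simp

text \<open>The sum counts departures from \<open>v\<close> plus arrivals at \<open>v\<close>, which
  are equally many on a closed walk. A loop enters with both of its orientations.\<close>

lemma even_degree_closed_walk:
  assumes "awalk u p u"
  shows "even (\<Sum>a\<in>{a \<in> arcs G. tail G a = v}. count_list (map (edge_of arev) p) (edge_of arev a))"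
    (is "even ?S")
proof -
  have p: "set p \<subseteq> arcs G" using assms by auto
  have "?S = (\<Sum>a\<in>{a \<in> arcs G. tail G a = v}. count_list p a)
    + (\<Sum>a\<in>{a \<in> arcs G. tail G a = v}. count_list p (arev a))"
    by (subst sum.distrib[symmetric]) (simp add: count_edge_of)
  also have "(\<Sum>a\<in>{a \<in> arcs G. tail G a = v}. count_list p (arev a))
    = (\<Sum>a\<in>{a \<in> arcs G. head G a = v}. count_list p a)"
    by (rule sum.reindex_bij_witness[of _ arev arev]) auto
  also have "\<dots> = count_list (map (tail G) p) v"
  proof -
    have "count_list (rotate1 xs) v = count_list xs v" for xs :: "'a list" by (cases xs) simp_all
    then show ?thesis using p head_closed_walk[OF assms] by (simp add: sum_count_list)
  qed
  finally show ?thesis using p by (simp add: sum_count_list)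
qed

lemma finite_edges: "finite (edges G arev)"
  by (simp add: edges_def)

lemma length_eq_sum_edges:
  assumes "set p \<subseteq> arcs G"
  shows "length p = (\<Sum>e\<in>edges G arev. count_list (map (edge_of arev) p) e)"
proof -
  have "set (map (edge_of arev) p) \<subseteq> edges G arev" using assms by (auto simp: edges_def)
  from sum_count_set[OF this finite_edges] show ?thesis by simp
qed

lemma eulerian_circuitD:
  assumes "eulerian_circuit G arev p"
  shows "set p \<subseteq> arcs G" "length p = card (edges G arev)" "distinct (map (edge_of arev) p)"
proof -
  show p: "set p \<subseteq> arcs G" using assms by (auto simp: eulerian_circuit_def)
  show "length p = card (edges G arev)"
    using assms length_eq_sum_edges[OF p] by (simp add: eulerian_circuit_def)
  show "distinct (map (edge_of arev) p)"
  proof (rule card_distinct)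
    have "set (map (edge_of arev) p) = edges G arev"
    proof (intro equalityI subsetI)
      fix e assume "e \<in> edges G arev"
      then have "count_list (map (edge_of arev) p) e = 1"
        using assms by (simp add: eulerian_circuit_def)
      then show "e \<in> set (map (edge_of arev) p)"
        by (metis count_notin zero_neq_one)
    qed (use p in \<open>auto simp: edges_def\<close>)
    then show "card (set (map (edge_of arev) p)) = length (map (edge_of arev) p)"
      using \<open>length p = card (edges G arev)\<close> by simp
  qed
qed

lemma eulerian_circuit_rotate1:
  assumes "eulerian_circuit G arev p"
  shows "eulerian_circuit G arev (rotate1 p)"
proof (cases p)
  case (Cons a q)
  obtain u where "awalk u p u" using assms by (auto simp: eulerian_circuit_def)
  then have "a \<in> arcs G" "u = tail G a" "awalk (head G a) q (tail G a)"
    using Cons by (auto simp: awalk_Cons_iff)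
  then have "awalk (head G a) (q @ [a]) (head G a)"
    by (intro awalk_appendI[OF _ arc_implies_awalk])
  moreover have "count_list (map (edge_of arev) (rotate1 p)) e = count_list (map (edge_of arev) p) e" for e
    using Cons by simp
  ultimately show ?thesis using assms Cons by (metis eulerian_circuit_def rotate1.simps(2))
qed (use assms in simp)

lemma eulerian_circuit_rotate:
  assumes "eulerian_circuit G arev p"
  shows "eulerian_circuit G arev (rotate k p)"
  by (induction k) (simp_all add: assms eulerian_circuit_rotate1)

lemma finite_walks: "finite {p. length p = k \<and> set p \<subseteq> arcs G}"
  using finite_lists_length_eq[OF finite_arcs, of k] by (simp add: conj_commute)

text \<open>Rotation preserves Eulerian circuits, so they split into full rotation classes, each of
  size m since the arcs are distinct. Without edges the empty circuit would form a class of size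
  1.\<close>

lemma card_eulerian_circuits:
  assumes "card (edges G arev) > 0"
  shows "card {p. eulerian_circuit G arev p} = card (edges G arev) * ec G arev"
proof -
  let ?A = "{p. eulerian_circuit G arev p}"
  have fin: "finite ?A"
    by (rule finite_subset[OF _ finite_walks[of "card (edges G arev)"]]) (auto dest: eulerian_circuitD)
  have "\<Union> (?A // rotation_rel) = ?A"
  proof (intro equalityI subsetI)
    fix p assume "p \<in> ?A"
    moreover have "(p, p) \<in> rotation_rel"
      by (auto simp: rotation_rel_def intro: exI[of _ 0])
    ultimately show "p \<in> \<Union> (?A // rotation_rel)" by (auto simp: quotient_def)
  qed (auto simp: quotient_def rotation_rel_def eulerian_circuit_rotate)
  moreover have "card (edges G arev) * card (?A // rotation_rel) = card (\<Union> (?A // rotation_rel))"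
  proof (rule card_partition)
    show "finite (?A // rotation_rel)" using fin by (simp add: quotient_def)
    show "finite (\<Union> (?A // rotation_rel))" using fin calculation by simp
    fix c assume "c \<in> ?A // rotation_rel"
    then obtain p where p: "eulerian_circuit G arev p" "c = rotation_rel `` {p}"
      by (auto simp: quotient_def)
    moreover have "p \<noteq> []" using eulerian_circuitD(2)[OF p(1)] assms by auto
    ultimately show "card c = card (edges G arev)"
      using card_rotation_class[of p] eulerian_circuitD[OF p(1)]
      by (auto simp: distinct_map)
  next
    fix c d assume cd: "c \<in> ?A // rotation_rel" "d \<in> ?A // rotation_rel" "c \<noteq> d"
    then have "c \<in> UNIV // rotation_rel" "d \<in> UNIV // rotation_rel" by (auto simp: quotient_def)
    then show "c \<inter> d = {}" using cd(3) quotient_disj[OF equiv_rotation_rel] by blast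
  qed
  ultimately show ?thesis by (simp add: ec_def)
qed

text \<open>Replaces walks by a condition on neighbouring arcs, the form in which
  \<open>feeds_into\<close> is stated.\<close>

lemma awalk_iff_successively:
  assumes "p \<noteq> []" "set p \<subseteq> arcs G"
  shows "awalk (tail G (hd p)) p v
    \<longleftrightarrow> successively (\<lambda>a b. head G a = tail G b) p \<and> head G (last p) = v"
  using assms
proof (induction p rule: list_nonempty_induct)
  case (single a)
  then show ?case by (auto simp: awalk_Cons_iff awalk_Nil_iff)
next
  case (cons a p)
  moreover have "awalk (head G a) p v \<Longrightarrow> head G a = tail G (hd p)"
    using cons.hyps by (cases p) (auto simp: awalk_Cons_iff)
  ultimately show ?case by (auto simp: awalk_Cons_iff successively_Cons)
qed

section \<open>Closed walks with a marked start, with and without backtracking\<close>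

definition closed_walks :: "nat \<Rightarrow> 'b list set" where
  "closed_walks k = {p. length p = k \<and> (\<exists>u. awalk u p u)}"

text \<open>Appending \<open>hd p\<close> makes the condition cyclic: the last arc must also feed
  into the first.\<close>

definition nonbacktracking_closed_walks :: "nat \<Rightarrow> 'b list set" where
  "nonbacktracking_closed_walks k =
    {p. length p = k \<and> set p \<subseteq> arcs G \<and> successively (feeds_into G arev) (p @ [hd p])}"

lemma finite_closed_walks: "finite (closed_walks k)"
  by (rule finite_subset[OF _ finite_walks[of k]]) (auto simp: closed_walks_def)

lemma nonbacktracking_closed_walks_subset:
  assumes "k > 0"
  shows "nonbacktracking_closed_walks k \<subseteq> closed_walks k"
proof
  fix p assume p: "p \<in> nonbacktracking_closed_walks k"
  then have "p \<noteq> []" "set p \<subseteq> arcs G" using assms by (auto simp: nonbacktracking_closed_walks_def)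
  moreover have "successively (\<lambda>a b. head G a = tail G b) (p @ [hd p])"
    using p by (auto simp: nonbacktracking_closed_walks_def feeds_into_def elim: successively_mono)
  ultimately have "awalk (tail G (hd p)) p (tail G (hd p))"
    by (simp add: awalk_iff_successively successively_append_iff)
  then show "p \<in> closed_walks k"
    using p by (auto simp: closed_walks_def nonbacktracking_closed_walks_def)
qed

text \<open>Backtracking, inside the circuit or where it closes up, would traverse an edge
  twice.\<close>

lemma eulerian_circuit_nonbacktracking:
  assumes "eulerian_circuit G arev p" "card (edges G arev) > 0"
  shows "p \<in> nonbacktracking_closed_walks (card (edges G arev))"
proof -
  note p = eulerian_circuitD[OF assms(1)]
  have ne: "p \<noteq> []" using p(2) assms(2) by auto
  obtain u where u: "awalk u p u" using assms by (auto simp: eulerian_circuit_def)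
  then have "u = tail G (hd p)" using ne by (cases p) (auto simp: awalk_Cons_iff)
  then have walk: "successively (\<lambda>a b. head G a = tail G b) p" "head G (last p) = tail G (hd p)"
    using awalk_iff_successively[OF ne p(1)] u by auto
  have "successively (\<lambda>a b. b \<noteq> arev a) p"
  proof (unfold successively_conv_nth, intro allI impI notI)
    fix i assume i: "Suc i < length p" "p ! Suc i = arev (p ! i)"
    then have "map (edge_of arev) p ! Suc i = map (edge_of arev) p ! i"
      by (simp add: edge_of_eq_iff)
    then show False using nth_eq_iff_index_eq[OF p(3), of "Suc i" i] i by simp
  qed
  moreover have "hd p \<noteq> arev (last p)"
  proof
    assume *: "hd p = arev (last p)"
    then have "map (edge_of arev) p ! 0 = map (edge_of arev) p ! (length p - 1)"
      using ne by (simp add: edge_of_eq_iff hd_conv_nth last_conv_nth)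
    \<comment> \<open>First and last position coincide only for a single loop, whose arc would then
      be its own inverse.\<close>
    then have "0 = length p - 1"
      using nth_eq_iff_index_eq[OF p(3), of 0 "length p - 1"] ne by simp
    then have "hd p = last p" using ne by (simp add: hd_conv_nth last_conv_nth)
    then show False using * arev_neq[of "last p"] p(1) ne by (auto simp: subset_iff)
  qed
  ultimately have "successively (\<lambda>a b. b \<noteq> arev a) (p @ [hd p])"
    "successively (\<lambda>a b. head G a = tail G b) (p @ [hd p])"
    using walk ne by (simp_all add: successively_append_iff)
  then have "successively (feeds_into G arev) (p @ [hd p])"
    unfolding feeds_into_def successively_conv_nth by blast
  then show ?thesis using p by (simp add: nonbacktracking_closed_walks_def)
qed

end

section \<open>Signed sums over closed walks\<close>

context multigraph_spanning_tree
begin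

lemma edges_T_subset: "edges T arev \<subseteq> edges G arev"
  using arcs_T_subset by (auto simp: edges_def)

lemma edge_of_in_coedges:
  assumes "a \<in> arcs G" "a \<notin> arcs T"
  shows "edge_of arev a \<in> coedges G arev T"
  using assms by (auto simp: coedges_def edges_def edge_of_eq_iff)

lemma finite_coedges: "finite (coedges G arev T)"
  using finite_edges by (simp add: coedges_def)

text \<open>A tree on n vertices has n - 1 edges, so the power of 2 produced by summing over all
  \<gamma> has the genus as its exponent.\<close>

lemma card_coedges: "int (card (coedges G arev T)) = genus G arev"
proof -
  have "card (coedges G arev T) = card (edges G arev) - card (edges T arev)"
    unfolding coedges_def by (rule card_Diff_subset[OF finite_subset[OF edges_T_subset finite_edges] edges_T_subset])
  moreover have "card (edges T arev) \<le> card (edges G arev)"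
    by (rule card_mono[OF finite_edges edges_T_subset])
  ultimately show ?thesis using card_edges_T by (simp add: genus_def)
qed

text \<open>The closed walk and an Eulerian circuit have, modulo 2, the same edge counts: the difference
  is an even subgraph of the tree.\<close>

lemma eulerian_circuit_if_odd_on_coedges:
  assumes "eulerian G arev" "p \<in> closed_walks (card (edges G arev))"
    and odd: "\<forall>e\<in>coedges G arev T. odd (count_list (map (edge_of arev) p) e)"
  shows "eulerian_circuit G arev p"
proof -
  let ?N = "\<lambda>e. count_list (map (edge_of arev) p) e"
  obtain q where q: "eulerian_circuit G arev q" using assms(1) by (auto simp: eulerian_def)
  obtain u where u: "awalk u p u" using assms(2) by (auto simp: closed_walks_def)
  obtain w where w: "awalk w q w" using q by (auto simp: eulerian_circuit_def)
  define F where "F = {a \<in> arcs G. even (?N (edge_of arev a))}"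
  have "F = {}"
  proof (rule even_subset_of_T_empty)
    show "F \<subseteq> arcs T" using odd edge_of_in_coedges by (auto simp: F_def)
    show "arev a \<in> F" if "a \<in> F" for a
    proof -
      have "edge_of arev (arev a) = edge_of arev a" by (simp add: edge_of_eq_iff)
      then show ?thesis using that by (simp add: F_def)
    qed
    fix v
    let ?O = "{a \<in> arcs G. tail G a = v}"
    have "count_list (map (edge_of arev) q) (edge_of arev a) = 1" if "a \<in> arcs G" for a
      using q that by (simp add: eulerian_circuit_def edges_def)
    \<comment> \<open>The degree sums of both walks at \<open>v\<close> are even. Adding the count 1
      of the circuit flips each parity, so the odd terms are exactly those from
      \<open>F\<close>.\<close>
    then have "even (\<Sum>a\<in>?O. ?N (edge_of arev a) + 1)"
      using even_degree_closed_walk[OF u, of v] even_degree_closed_walk[OF w, of v]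
      by (simp add: sum.distrib del: add_Suc_right)
    then have "even (card {a \<in> ?O. odd (?N (edge_of arev a) + 1)})"
      using even_sum_iff[of ?O "\<lambda>a. ?N (edge_of arev a) + 1"] by simp
    moreover have "{a \<in> ?O. odd (?N (edge_of arev a) + 1)} = {a \<in> F. tail G a = v}"
      by (auto simp: F_def)
    ultimately show "even (card {a \<in> F. tail G a = v})" by simp
  qed
  then have N: "odd (?N e)" if "e \<in> edges G arev" for e
    using that by (auto simp: F_def edges_def)
  then have pos: "1 \<le> ?N e" if "e \<in> edges G arev" for e
    using N[OF that] odd_pos by fastforce
  \<comment> \<open>The counts are at least 1 and add up to the number of edges, so every excess
    over 1 is 0.\<close>
  have "(\<Sum>e\<in>edges G arev. ?N e) = card (edges G arev)"
    using length_eq_sum_edges[of p] u assms(2) by (auto simp: closed_walks_def)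
  then have "(\<Sum>e\<in>edges G arev. ?N e - 1) = 0"
    using pos by (subst sum_subtractf_nat) auto
  then have "\<forall>e\<in>edges G arev. ?N e = 1" using pos finite_edges by (auto simp: le_antisym)
  then show ?thesis using u by (auto simp: eulerian_circuit_def)
qed

text \<open>The set \<open>X\<close> is left open because the two matrices count different closed
  walks. Exchanging the sums leaves only the Eulerian circuits, each with weight 2 to the number of
  edges outside the tree.\<close>

lemma sum_M2_closed_walks:
  assumes "eulerian G arev" "card (edges G arev) > 0"
    and "{p. eulerian_circuit G arev p} \<subseteq> X" "X \<subseteq> closed_walks (card (edges G arev))"
  shows "(\<Sum>\<gamma>\<in>M2 (coedges G arev T). neg_one_pow (\<sigma> (coedges G arev T) \<gamma>) *
      (\<Sum>p\<in>X. walk_weight arev \<gamma> p))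
    = 2 ^ card (coedges G arev T) * (real (card (edges G arev)) * real (ec G arev))"
proof -
  let ?E = "coedges G arev T"
  have fin: "finite X" using assms(4) finite_closed_walks finite_subset by blast
  have "(\<Sum>\<gamma>\<in>M2 ?E. neg_one_pow (\<sigma> ?E \<gamma>) * (\<Sum>p\<in>X. walk_weight arev \<gamma> p))
    = (\<Sum>p\<in>X. \<Sum>\<gamma>\<in>M2 ?E. neg_one_pow (\<sigma> ?E \<gamma>) * walk_weight arev \<gamma> p)"
    by (subst sum.swap) (simp add: sum_distrib_left)
  also have "\<dots> = (\<Sum>p\<in>X. if eulerian_circuit G arev p then 2 ^ card ?E else 0)"
  proof (rule sum.cong[OF refl])
    fix p assume p: "p \<in> X"
    have "(\<forall>e\<in>?E. odd (count_list (map (edge_of arev) p) e)) \<longleftrightarrow> eulerian_circuit G arev p"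
      using eulerian_circuit_if_odd_on_coedges[OF assms(1), of p] assms(4) p
      by (auto simp: eulerian_circuit_def coedges_def)
    then show "(\<Sum>\<gamma>\<in>M2 ?E. neg_one_pow (\<sigma> ?E \<gamma>) * walk_weight arev \<gamma> p)
      = (if eulerian_circuit G arev p then 2 ^ card ?E else 0)"
      by (simp add: sum_M2_walk_weight[OF finite_coedges])
  qed
  also have "\<dots> = 2 ^ card ?E * real (card {p \<in> X. eulerian_circuit G arev p})"
    using fin by (simp add: sum.If_cases Int_def)
  also have "{p \<in> X. eulerian_circuit G arev p} = {p. eulerian_circuit G arev p}"
    using assms(3) by auto
  finally show ?thesis using card_eulerian_circuits[OF assms(2)] by simp
qed

text \<open>On the tree the canonical element is 0 and the end colours are opposite. Off the tree it
  is 1 exactly when the tree path is even, that is, when the end colours agree.\<close>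

lemma chi_add_canonical:
  assumes "a \<in> arcs G"
  shows "\<chi> arev (\<gamma> + canonical G arev T) a
    = - (colour (tail G a) * colour (head G a)) * \<chi> arev \<gamma> a"
proof (cases "a \<in> arcs T")
  case True
  then have "edge_of arev a \<notin> coedges G arev T" by (auto simp: coedges_def edges_def)
  then have "canonical G arev T (edge_of arev a) = 0" by (simp add: canonical_def)
  then show ?thesis using colour_arc_T[OF True] by (simp add: \<chi>_def)
next
  case False
  have "odd (length (tree_path T (tail G b) (head G b)))
      \<longleftrightarrow> colour (tail G a) * colour (head G a) = - 1"
    if "b \<in> edge_of arev a" for b
  proof -
    have "colour (tail G a) * colour (head G a) = colour (tail G b) * colour (head G b)"
      using that assms by (auto simp: edge_of_def)
    moreover have "b \<in> arcs G" using that assms by (auto simp: edge_of_def)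
    ultimately show ?thesis by (simp add: colour_tree_path minus_one_power_iff)
  qed
  moreover have "colour (tail G a) * colour (head G a) \<in> {1, - 1}"
    using assms by (simp add: colour_tree_path minus_one_power_iff)
  moreover have "a \<in> edge_of arev a" by (simp add: edge_of_def)
  ultimately have "neg_one_pow (canonical G arev T (edge_of arev a))
      = - (colour (tail G a) * colour (head G a))"
    using edge_of_in_coedges[OF assms False] by (auto simp: canonical_def)
  then show ?thesis by (simp add: \<chi>_def neg_one_pow_add del: add_bit_eq_xor)
qed

text \<open>Every arc contributes minus the product of its end colours. On a closed walk the heads
  are a shift of the tails, so the colours combine to squares and only the minus signs
  remain.\<close>

lemma walk_weight_add_canonical:
  assumes "awalk u p u"
  shows "walk_weight arev (\<gamma> + canonical G arev T) p = (- 1) ^ length p * walk_weight arev \<gamma> p"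
proof -
  define c where "c xs = prod_list (map colour xs)" for xs
  have c_Cons: "c (x # xs) = colour x * c xs" for x xs by (simp add: c_def)
  have "walk_weight arev (\<gamma> + canonical G arev T) p
    = (- 1) ^ length p * (c (map (tail G) p) * c (map (head G) p)) * walk_weight arev \<gamma> p"
    if "set p \<subseteq> arcs G" for p
    using that
    by (induction p) (simp_all add: walk_weight_def chi_add_canonical c_def algebra_simps)
  moreover have "c (rotate1 xs) = c xs" for xs by (cases xs) (simp_all add: c_def)
  moreover have "c xs * c xs = 1" for xs
  proof (induction xs)
    case (Cons x xs)
    have "c (x # xs) * c (x # xs) = (colour x * colour x) * (c xs * c xs)"
      by (simp only: c_Cons mult_ac)
    then show ?case using Cons by simp
  qed (simp add: c_def)
  moreover have "set p \<subseteq> arcs G" using assms by auto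
  ultimately show ?thesis using head_closed_walk[OF assms] by simp
qed

lemma canonical_in_M2: "canonical G arev T \<in> M2 (coedges G arev T)"
  by (simp add: canonical_def M2_def)

text \<open>An Eulerian circuit uses each edge once, so its weight under the canonical element is
  the left side; comparing with \<gamma> = 0, where the weight is 1, gives the right side.\<close>

lemma neg_one_pow_sigma_canonical:
  assumes "eulerian G arev"
  shows "neg_one_pow (\<sigma> (coedges G arev T) (canonical G arev T)) = (- 1) ^ card (edges G arev)"
proof -
  obtain q where q: "eulerian_circuit G arev q" using assms by (auto simp: eulerian_def)
  obtain u where u: "awalk u q u" using q by (auto simp: eulerian_circuit_def)
  have "walk_weight arev (canonical G arev T) q = neg_one_pow (\<sigma> (coedges G arev T) (canonical G arev T))"
    using q
    by (simp add: walk_weight_eq_prod_edges[OF finite_coedges canonical_in_M2] \<sigma>_def neg_one_pow_sum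
        eulerian_circuit_def coedges_def)
  moreover have "walk_weight arev 0 q = 1"
    by (induction q) (simp_all add: walk_weight_def \<chi>_def)
  ultimately show ?thesis
    using walk_weight_add_canonical[OF u, of 0] eulerian_circuitD(2)[OF q] by simp
qed

text \<open>Adding the canonical element is a self-inverse exchange of the two halves. It multiplies
  both the sign of \<sigma> and the walk sum by (-1)^m, so the summand is unchanged and each half
  carries half of the full sum.\<close>

lemma half_sum_closed_walks:
  assumes "eulerian G arev" "card (edges G arev) > 0"
    and "{p. eulerian_circuit G arev p} \<subseteq> X" "X \<subseteq> closed_walks (card (edges G arev))"
    and "S\<^sub>1 \<union> S\<^sub>2 = M2 (coedges G arev T)" "S\<^sub>1 \<inter> S\<^sub>2 = {}"
    and "\<And>\<gamma>. \<gamma> \<in> S\<^sub>1 \<Longrightarrow> \<gamma> + canonical G arev T \<in> S\<^sub>2"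
    and "\<And>\<gamma>. \<gamma> \<in> S\<^sub>2 \<Longrightarrow> \<gamma> + canonical G arev T \<in> S\<^sub>1"
  shows "real (ec G arev) = 1 / (real (card (edges G arev)) * 2 powi (genus G arev - 1)) *
    (\<Sum>\<gamma>\<in>S\<^sub>1. neg_one_pow (\<sigma> (coedges G arev T) \<gamma>) * (\<Sum>p\<in>X. walk_weight arev \<gamma> p))"
proof -
  let ?E = "coedges G arev T" and ?c = "canonical G arev T" and ?m = "card (edges G arev)"
  let ?f = "\<lambda>\<gamma>. neg_one_pow (\<sigma> ?E \<gamma>) * (\<Sum>p\<in>X. walk_weight arev \<gamma> p)"
  have add: "\<gamma> + ?c + ?c = \<gamma>" for \<gamma> by (rule ext) simp
  have f: "?f (\<gamma> + ?c) = ?f \<gamma>" for \<gamma>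
  proof -
    have "walk_weight arev (\<gamma> + ?c) p = (- 1) ^ ?m * walk_weight arev \<gamma> p" if "p \<in> X" for p
      using that assms(4) walk_weight_add_canonical by (fastforce simp: closed_walks_def)
    then have "(\<Sum>p\<in>X. walk_weight arev (\<gamma> + ?c) p) = (- 1) ^ ?m * (\<Sum>p\<in>X. walk_weight arev \<gamma> p)"
      by (simp add: sum_distrib_left)
    moreover have "neg_one_pow (\<sigma> ?E (\<gamma> + ?c)) = neg_one_pow (\<sigma> ?E \<gamma>) * (- 1) ^ ?m"
      using neg_one_pow_sigma_canonical[OF assms(1)]
      by (simp add: \<sigma>_def sum.distrib neg_one_pow_add del: add_bit_eq_xor)
    ultimately show ?thesis by (simp flip: power_mult_distrib)
  qed
  have fin: "finite S\<^sub>1" "finite S\<^sub>2"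
    using finite_M2[OF finite_coedges] assms(5) by (metis finite_Un)+
  have "sum ?f S\<^sub>1 = sum ?f S\<^sub>2"
    by (rule sum.reindex_bij_witness[of _ "\<lambda>\<gamma>. \<gamma> + ?c" "\<lambda>\<gamma>. \<gamma> + ?c"])
      (use assms(7,8) add f in auto)
  moreover have "sum ?f S\<^sub>1 + sum ?f S\<^sub>2 = 2 ^ card ?E * (real ?m * real (ec G arev))"
    using sum.union_disjoint[OF fin assms(6), of ?f] sum_M2_closed_walks[OF assms(1-4)] assms(5)
    by simp
  ultimately have "sum ?f S\<^sub>1 = 2 ^ card ?E / 2 * (real ?m * real (ec G arev))" by simp
  moreover have "2 powi (genus G arev - 1) = (2 ^ card ?E / 2 :: real)"
    by (simp add: card_coedges[symmetric] power_int_diff)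
  ultimately show ?thesis using assms(2) by (simp only:) (simp add: field_simps)
qed

end

section \<open>Traces of matrix powers\<close>

text \<open>Any \<open>F\<close> satisfying the recursion of right multiplication gives the entries
  of the powers. This frees both trace computations from the enumeration.\<close>

lemma trace_pow_mat:
  fixes f :: "'x \<Rightarrow> 'x \<Rightarrow> 'b :: semiring_1" and F :: "nat \<Rightarrow> 'x \<Rightarrow> 'x \<Rightarrow> 'b"
  assumes "distinct xs"
    and F_0: "\<And>x y. x \<in> set xs \<Longrightarrow> y \<in> set xs \<Longrightarrow> F 0 x y = (if x = y then 1 else 0)"
    and F_Suc: "\<And>k x y. x \<in> set xs \<Longrightarrow> y \<in> set xs \<Longrightarrow>
      F (Suc k) x y = (\<Sum>z\<in>set xs. F k x z * f z y)"
  shows "trace (mat (length xs) (length xs) (\<lambda>(i, j). f (xs ! i) (xs ! j)) ^\<^sub>m k)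
    = (\<Sum>x\<in>set xs. F k x x)"
proof -
  let ?M = "mat (length xs) (length xs) (\<lambda>(i, j). f (xs ! i) (xs ! j))"
  have sum_set: "(\<Sum>i<length xs. h (xs ! i)) = (\<Sum>x\<in>set xs. h x)" for h :: "'x \<Rightarrow> 'b"
    by (rule sum.reindex_bij_betw[OF bij_betw_nth[OF assms(1) refl refl]])
  have entry: "(?M ^\<^sub>m k) $$ (i, j) = F k (xs ! i) (xs ! j)"
    if "i < length xs" "j < length xs" for i j
    using that
  proof (induction k arbitrary: j)
    case 0
    then show ?case using assms(1) by (simp add: F_0 nth_eq_iff_index_eq)
  next
    case (Suc k)
    have "(?M ^\<^sub>m Suc k) $$ (i, j) = (\<Sum>l<length xs. (?M ^\<^sub>m k) $$ (i, l) * ?M $$ (l, j))"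
      using Suc.prems by (simp add: scalar_prod_def lessThan_atLeast0)
    also have "\<dots> = (\<Sum>l<length xs. F k (xs ! i) (xs ! l) * f (xs ! l) (xs ! j))"
      using Suc by (intro sum.cong) simp_all
    also have "\<dots> = F (Suc k) (xs ! i) (xs ! j)"
      using Suc.prems sum_set[of "\<lambda>z. F k (xs ! i) z * f z (xs ! j)"] by (simp add: F_Suc)
    finally show ?case .
  qed
  then show ?thesis using sum_set[of "\<lambda>x. F k x x"] by (simp add: trace_def)
qed

lemma walk_weight_append_single:
  "walk_weight arev \<gamma> (p @ [a]) = walk_weight arev \<gamma> p * \<chi> arev \<gamma> a"
  by (simp add: walk_weight_def)

context multigraph
begin

text \<open>\<open>F k u v\<close> sums the weights of the walks of length k from u to v; splitting
  off the last arc gives the matrix recursion. The length is positive because the empty walk would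
  count once for every vertex in the trace.\<close>

lemma trace_adj_mat_pow:
  assumes "distinct vs" "set vs = verts G" "k > 0"
  shows "trace (adj_mat G arev vs \<gamma> ^\<^sub>m k) = (\<Sum>p\<in>closed_walks k. walk_weight arev \<gamma> p)"
proof -
  define W where "W k u v = {p. length p = k \<and> awalk u p v}" for k u v
  define F where "F k u v = (\<Sum>p\<in>W k u v. walk_weight arev \<gamma> p)" for k u v
  define A where "A u v = {a \<in> arcs G. tail G a = u \<and> head G a = v}" for u v
  have finite_W: "finite (W k u v)" for k u v
    by (rule finite_subset[OF _ finite_walks[of k]]) (auto simp: W_def)
  have F_Suc: "F (Suc k) u v = (\<Sum>w\<in>verts G. F k u w * (\<Sum>a\<in>A w v. \<chi> arev \<gamma> a))" for k u v
  proof -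
    have last: "{p \<in> W (Suc k) u v. tail G (last p) = w} = (\<lambda>(p, a). p @ [a]) ` (W k u w \<times> A w v)"
      (is "?L = ?R") for w
    proof (intro equalityI subsetI)
      fix p assume p: "p \<in> ?L"
      then have "p \<noteq> []" by (auto simp: W_def)
      then obtain q a where "p = q @ [a]" by (metis append_butlast_last_id)
      then show "p \<in> ?R"
        using p by (auto simp: W_def A_def awalk_Cons_iff awalk_Nil_iff intro!: image_eqI[of _ _ "(q, a)"])
    qed (auto simp: W_def A_def intro!: awalk_appendI[OF _ arc_implies_awalk])
    have "F (Suc k) u v = (\<Sum>w\<in>verts G. \<Sum>p\<in>{p \<in> W (Suc k) u v. tail G (last p) = w}. walk_weight arev \<gamma> p)"
      unfolding F_def
    proof (rule sum.group[symmetric, OF finite_W finite_verts], rule image_subsetI)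
      fix p assume "p \<in> W (Suc k) u v"
      then have "last p \<in> set p" "set p \<subseteq> arcs G" by (auto simp: W_def intro!: last_in_set)
      then show "tail G (last p) \<in> verts G" by auto
    qed
    also have "\<dots> = (\<Sum>w\<in>verts G. F k u w * (\<Sum>a\<in>A w v. \<chi> arev \<gamma> a))"
    proof (rule sum.cong[OF refl])
      fix w
      have "(\<Sum>p\<in>{p \<in> W (Suc k) u v. tail G (last p) = w}. walk_weight arev \<gamma> p)
        = (\<Sum>(p, a)\<in>W k u w \<times> A w v. walk_weight arev \<gamma> p * \<chi> arev \<gamma> a)"
        unfolding last
        by (subst sum.reindex) (auto simp: inj_on_def walk_weight_append_single intro!: sum.cong)
      then show "(\<Sum>p\<in>{p \<in> W (Suc k) u v. tail G (last p) = w}. walk_weight arev \<gamma> p)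
        = F k u w * (\<Sum>a\<in>A w v. \<chi> arev \<gamma> a)"
        by (simp add: F_def sum_product sum.cartesian_product)
    qed
    finally show ?thesis .
  qed
  have "W 0 u v = (if u = v then {[]} else {})" if "u \<in> verts G" for u v
    using that by (auto simp: W_def awalk_Nil_iff)
  then have F_0: "F 0 u v = (if u = v then 1 else 0)" if "u \<in> verts G" for u v
    using that by (simp add: F_def walk_weight_def)
  have "trace (adj_mat G arev vs \<gamma> ^\<^sub>m k) = (\<Sum>u\<in>verts G. F k u u)"
    unfolding adj_mat_def
    using trace_pow_mat[OF assms(1), of F "\<lambda>u v. \<Sum>a\<in>A u v. \<chi> arev \<gamma> a"] F_0 F_Suc assms(2)
    by (simp add: A_def)
  \<comment> \<open>A nonempty closed walk is grouped under the tail of its first arc.\<close>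
  also have "\<dots> = (\<Sum>u\<in>verts G. \<Sum>p\<in>{p \<in> closed_walks k. tail G (hd p) = u}. walk_weight arev \<gamma> p)"
  proof (rule sum.cong[OF refl])
    fix u
    have "{p \<in> closed_walks k. tail G (hd p) = u} = W k u u"
    proof -
      have "tail G (hd p) = w" if "awalk w p w" "length p = k" for p w
        using that assms(3) by (cases p) (auto simp: awalk_Cons_iff)
      then show ?thesis unfolding closed_walks_def W_def by blast
    qed
    then show "F k u u = (\<Sum>p\<in>{p \<in> closed_walks k. tail G (hd p) = u}. walk_weight arev \<gamma> p)"
      by (simp add: F_def)
  qed
  also have "\<dots> = (\<Sum>p\<in>closed_walks k. walk_weight arev \<gamma> p)"
  proof (rule sum.group[OF finite_closed_walks finite_verts], rule image_subsetI)
    fix p assume "p \<in> closed_walks k"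
    then have "hd p \<in> set p" "set p \<subseteq> arcs G" using assms(3) by (auto simp: closed_walks_def)
    then show "tail G (hd p) \<in> verts G" by auto
  qed
  finally show ?thesis .
qed

text \<open>The same scheme, with arcs as states and each step required to satisfy
  \<open>feeds_into\<close>.\<close>

lemma trace_edge_mat_pow:
  assumes "distinct os" "set os = arcs G" "k > 0"
  shows "trace (edge_mat G arev os \<gamma> ^\<^sub>m k)
    = (\<Sum>p\<in>nonbacktracking_closed_walks k. walk_weight arev \<gamma> p)"
proof -
  \<comment> \<open>The target \<open>b\<close> is the arc following \<open>p\<close> and carries no
    weight, as an entry of the matrix is weighted by its row arc. Writing
    \<open>hd (p @ [b])\<close> covers the empty list, where \<open>a\<close> must equal
    \<open>b\<close>.\<close>
  define W where "W k a b = {p. length p = k \<and> set p \<subseteq> arcs G \<and> hd (p @ [b]) = a \<and>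
    successively (feeds_into G arev) (p @ [b])}" for k a b
  define F where "F k a b = (\<Sum>p\<in>W k a b. walk_weight arev \<gamma> p)" for k a b
  define w where "w a b = (if feeds_into G arev a b then \<chi> arev \<gamma> a else 0)" for a b
  have finite_W: "finite (W k a b)" for k a b
    by (rule finite_subset[OF _ finite_walks[of k]]) (auto simp: W_def)
  have F_Suc: "F (Suc k) a b = (\<Sum>c\<in>arcs G. F k a c * w c b)" for k a b
  proof -
    have last: "{p \<in> W (Suc k) a b. last p = c} =
        (if feeds_into G arev c b then (\<lambda>p. p @ [c]) ` W k a c else {})" (is "?L = ?R")
      if "c \<in> arcs G" for c
    proof (intro equalityI subsetI)
      fix p assume p: "p \<in> ?L"
      then have "p \<noteq> []" by (auto simp: W_def)
      with p obtain q where "p = q @ [c]" by (metis (mono_tags, lifting) append_butlast_last_id mem_Collect_eq)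
      then show "p \<in> ?R"
        using p by (auto simp: W_def successively_append_iff hd_append)
    qed (use that in \<open>auto simp: W_def successively_append_iff hd_append split: if_splits\<close>)
    have "F (Suc k) a b = (\<Sum>c\<in>arcs G. \<Sum>p\<in>{p \<in> W (Suc k) a b. last p = c}. walk_weight arev \<gamma> p)"
      unfolding F_def
    proof (rule sum.group[symmetric, OF finite_W finite_arcs], rule image_subsetI)
      fix p assume "p \<in> W (Suc k) a b"
      then have "last p \<in> set p" "set p \<subseteq> arcs G" by (auto simp: W_def intro!: last_in_set)
      then show "last p \<in> arcs G" by auto
    qed
    also have "\<dots> = (\<Sum>c\<in>arcs G. F k a c * w c b)"
    proof (rule sum.cong[OF refl])
      fix c assume "c \<in> arcs G"
      then show "(\<Sum>p\<in>{p \<in> W (Suc k) a b. last p = c}. walk_weight arev \<gamma> p) = F k a c * w c b"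
        by (auto simp: last w_def F_def sum.reindex inj_on_def walk_weight_append_single
            sum_distrib_right)
    qed
    finally show ?thesis .
  qed
  have "W 0 a b = (if a = b then {[]} else {})" for a b
    by (auto simp: W_def)
  then have F_0: "F 0 a b = (if a = b then 1 else 0)" for a b
    by (simp add: F_def walk_weight_def)
  have "trace (edge_mat G arev os \<gamma> ^\<^sub>m k) = (\<Sum>a\<in>arcs G. F k a a)"
    unfolding edge_mat_def
    using trace_pow_mat[OF assms(1), of F w] F_0 F_Suc assms(2) by (simp add: w_def)
  also have "\<dots> = (\<Sum>a\<in>arcs G. \<Sum>p\<in>{p \<in> nonbacktracking_closed_walks k. hd p = a}. walk_weight arev \<gamma> p)"
  proof (rule sum.cong[OF refl])
    fix a
    \<comment> \<open>On the diagonal \<open>b\<close> is the first arc of \<open>p\<close>, so the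
      condition becomes the cyclic one.\<close>
    have "W k a a = {p \<in> nonbacktracking_closed_walks k. hd p = a}"
      using assms(3) by (auto simp: W_def nonbacktracking_closed_walks_def hd_append)
    then show "F k a a = (\<Sum>p\<in>{p \<in> nonbacktracking_closed_walks k. hd p = a}. walk_weight arev \<gamma> p)"
      by (simp add: F_def)
  qed
  also have "\<dots> = (\<Sum>p\<in>nonbacktracking_closed_walks k. walk_weight arev \<gamma> p)"
  proof (rule sum.group[OF _ finite_arcs], rule_tac [2] image_subsetI)
    show "finite (nonbacktracking_closed_walks k)"
      using nonbacktracking_closed_walks_subset[OF assms(3)] finite_closed_walks finite_subset by blast
    fix p assume "p \<in> nonbacktracking_closed_walks k"
    then have "hd p \<in> set p" "set p \<subseteq> arcs G" using assms(3) by (auto simp: nonbacktracking_closed_walks_def)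
    then show "hd p \<in> arcs G" by auto
  qed
  finally show ?thesis .
qed

text \<open>Without arcs, any division of the vertices into two sets would be a bipartition.\<close>

lemma card_edges_pos:
  assumes "\<not> bipartite G"
  shows "card (edges G arev) > 0"
proof -
  have "arcs G \<noteq> {}" using assms unfolding bipartite_def by blast
  then show ?thesis using finite_edges by (simp add: edges_def card_gt_0_iff)
qed

end

theorem theorem6p2:
  fixes G T :: "('v, 'a) pre_digraph" and arev :: "'a \<Rightarrow> 'a"
    and vs :: "'v list" and os :: "'a list"
    and S\<^sub>1 S\<^sub>2 :: "('a set \<Rightarrow> bit) set" and m :: nat and g :: int
    and \<gamma>\<^sub>T :: "'a set \<Rightarrow> bit" and E\<^sub>c :: "'a set set"
  assumes "multigraph G arev" and "\<not> bipartite G" and "eulerian G arev"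
    and "distinct vs" and "set vs = verts G"
    and "distinct os" and "set os = arcs G"
    and "m = card (edges G arev)" and "g = genus G arev"
    and "is_spanning_tree G arev T"
    and "E\<^sub>c = coedges G arev T" and "\<gamma>\<^sub>T = canonical G arev T"
    and "partition_on (M2 E\<^sub>c) {S\<^sub>1, S\<^sub>2}" and "S\<^sub>1 \<noteq> S\<^sub>2"
    and "\<forall>\<gamma>\<in>M2 E\<^sub>c. \<gamma> \<noteq> \<gamma> + \<gamma>\<^sub>T \<and>
           (\<gamma> \<in> S\<^sub>1 \<longrightarrow> \<gamma> + \<gamma>\<^sub>T \<in> S\<^sub>2) \<and> (\<gamma> \<in> S\<^sub>2 \<longrightarrow> \<gamma> + \<gamma>\<^sub>T \<in> S\<^sub>1)"
  shows "\<forall>S\<in>{S\<^sub>1, S\<^sub>2}.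
    real (ec G arev) = 1 / (real m * 2 powi (g - 1)) *
        (\<Sum>\<gamma>\<in>S. neg_one_pow (\<sigma> E\<^sub>c \<gamma>) * trace (edge_mat G arev os \<gamma> ^\<^sub>m m)) \<and>
    real (ec G arev) = 1 / (real m * 2 powi (g - 1)) *
        (\<Sum>\<gamma>\<in>S. neg_one_pow (\<sigma> E\<^sub>c \<gamma>) * trace (adj_mat G arev vs \<gamma> ^\<^sub>m m))"
proof -
  interpret multigraph G arev by (fact assms(1))
  interpret multigraph_spanning_tree G arev T
    by unfold_locales (fact assms(10))
  have pos: "card (edges G arev) > 0" using card_edges_pos assms(2) by blast
  have un: "S\<^sub>1 \<union> S\<^sub>2 = M2 E\<^sub>c"
    using partition_onD1[OF assms(13)] by simp
  have disj: "S\<^sub>1 \<inter> S\<^sub>2 = {}"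
    using partition_onD2[OF assms(13)] assms(14) by (auto simp: disjoint_def)
  have shift: "\<gamma> \<in> S\<^sub>1 \<Longrightarrow> \<gamma> + \<gamma>\<^sub>T \<in> S\<^sub>2" "\<gamma> \<in> S\<^sub>2 \<Longrightarrow> \<gamma> + \<gamma>\<^sub>T \<in> S\<^sub>1" for \<gamma>
    using assms(15) un by blast+
  \<comment> \<open>The hypotheses are symmetric in the two halves, so exchanging them covers both
    values of \<open>S\<close>.\<close>
  have half: "real (ec G arev) = 1 / (real m * 2 powi (g - 1)) *
      (\<Sum>\<gamma>\<in>S. neg_one_pow (\<sigma> E\<^sub>c \<gamma>) * (\<Sum>p\<in>X. walk_weight arev \<gamma> p))"
    if "S \<in> {S\<^sub>1, S\<^sub>2}" "{p. eulerian_circuit G arev p} \<subseteq> X" "X \<subseteq> closed_walks m" for S X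
    using half_sum_closed_walks[OF assms(3) pos, of X S\<^sub>1 S\<^sub>2]
      half_sum_closed_walks[OF assms(3) pos, of X S\<^sub>2 S\<^sub>1]
      that un disj shift assms(8,9,11,12) by (auto simp: Un_commute Int_commute)
  have circuits: "{p. eulerian_circuit G arev p} \<subseteq> nonbacktracking_closed_walks m"
    using eulerian_circuit_nonbacktracking pos assms(8) by blast
  have subset: "nonbacktracking_closed_walks m \<subseteq> closed_walks m"
    using nonbacktracking_closed_walks_subset pos assms(8) by blast
  \<comment> \<open>The edge matrix takes \<open>X\<close> to be the closed walks without
    backtracking, the adjacency matrix takes all closed walks.\<close>
  show ?thesis
    using half[OF _ circuits subset] half[OF _ order.trans[OF circuits subset] order.refl] pos assms(8)
    by (simp add: trace_edge_mat_pow[OF assms(6,7)] trace_adj_mat_pow[OF assms(4,5)])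
qed

end
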